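(* Let $\alpha\in\mathbb{N}^{m\times n}$ be a matrix of nonnegative integers. Suppose $X\subset\mathbb{R}^n_+$ is representable as $X=\mathrm{cl}\{x\in\mathbb{R}^n : \mathbf{0}<x,\ H(x)\le\mathbf{1}\}$ for a continuous map $H:\mathbb{R}^n\to\mathbb{R}^r$. Then for $Y=\{y\in\mathbb{R}^n : H(\exp y)\le\mathbf{1}\}$, we have $$\mathsf{C}_{\mathsf{SAGE}}^{\mathsf{POLY}}(\alpha,X)=\mathsf{C}_{\mathsf{SAGE}}(\alpha,Y).$$
   Context: Vector inequalities (strict and non-strict) are elementwise, $\exp$ acts elementwise on vectors, $\mathbf{1}$ is the all-ones vector, and $\mathrm{cl}$ is closure in the standard topology of $\mathbb{R}^n$. $\mathbb{N}$ contains $0$. Write $\alpha_1,\dots,\alpha_m$ for the rows of $\alpha$. For a vector $c\in\mathbb{R}^m$, $c_{\setminus k}$ is $c$ with its $k$-th entry deleted. Sums of sets are Minkowski sums. Signomials: $\mathrm{Sig}(\alpha,c)$ is the function $y\mapsto\sum_{j=1}^m c_j\exp(\alpha_j\cdot y)$ on $\mathbb{R}^n$. For any $Y\subset\mathbb{R}^n$ and $k \in \{1,\dots,m\}$, $$\mathsf{C}_{\mathsf{AGE}}(\alpha,k,Y)=\{c\in\mathbb{R}^m : c_{\setminus k}\ge\mathbf{0},\ \mathrm{Sig}(\alpha,c)(y)\ge0 \text{ for all } y\in Y\},\qquad \mathsf{C}_{\mathsf{SAGE}}(\alpha,Y)=\sum_{k=1}^m\mathsf{C}_{\mathsf{AGE}}(\alpha,k,Y).$$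 Polynomials: $x^{\alpha_j}=\prod_{l=1}^n x_l^{\alpha_{jl}}$ (with $0^0=1$), and $\mathrm{Poly}(\alpha,c)$ is the polynomial $x\mapsto\sum_{j=1}^m c_j x^{\alpha_j}$. For any $X\subset\mathbb{R}^n$ and $i \in \{1,\dots,m\}$, $\mathsf{C}_{\mathsf{AGE}}^{\mathsf{POLY}}(\alpha,i,X)$ is the set of $c\in\mathbb{R}^m$ such that: (1) $\mathrm{Poly}(\alpha,c)(x)\ge0$ for all $x\in X$; (2) $c_j\ge0$ whenever $j\ne i$ and $x^{\alpha_j}>0$ for some $x\in X$; (3) $c_j\le0$ whenever $j\ne i$ and $x^{\alpha_j}<0$ for some $x\in X$. Then $$\mathsf{C}_{\mathsf{SAGE}}^{\mathsf{POLY}}(\alpha,X)=\sum_{k=1}^m\mathsf{C}_{\mathsf{AGE}}^{\mathsf{POLY}}(\alpha,k,X).$$ *)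

theory Defs
  imports "HOL-Analysis.Analysis" "HOL-Library.Set_Algebras"
begin

text \<open>
  A matrix with \<open>m\<close> rows and \<open>n\<close> columns has type \<open>_ ^ 'n ^ 'm\<close>; its row \<open>j\<close> is \<open>\<alpha> $ j\<close>.
  The library order \<open>\<le>\<close> on vectors is entrywise, but \<open><\<close> is only its strict part
  (\<open>x \<le> y \<and> \<not> y \<le> x\<close>), so strict entrywise inequalities are written out.  The vector \<open>1\<close>
  is the all-ones vector.  Sums of sets are Minkowski sums, as in \<^theory>\<open>HOL-Library.Set_Algebras\<close>.
\<close>

definition exp_vec :: "real ^ 'n \<Rightarrow> real ^ 'n" where
  "exp_vec y = (\<chi> l. exp (y $ l))"

definition Sig :: "real ^ 'n ^ 'm \<Rightarrow> real ^ 'm \<Rightarrow> real ^ 'n \<Rightarrow> real" where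
  "Sig \<alpha> c y = (\<Sum>j\<in>UNIV. c $ j * exp (\<alpha> $ j \<bullet> y))"

definition C_AGE :: "real ^ 'n ^ 'm \<Rightarrow> 'm \<Rightarrow> (real ^ 'n) set \<Rightarrow> (real ^ 'm) set" where
  "C_AGE \<alpha> k Y = {c. (\<forall>j. j \<noteq> k \<longrightarrow> 0 \<le> c $ j) \<and> (\<forall>y\<in>Y. 0 \<le> Sig \<alpha> c y)}"

definition C_SAGE :: "real ^ 'n ^ 'm \<Rightarrow> (real ^ 'n) set \<Rightarrow> (real ^ 'm) set" where
  "C_SAGE \<alpha> Y = (\<Sum>k\<in>UNIV. C_AGE \<alpha> k Y)"

definition monomial :: "real ^ 'n \<Rightarrow> nat ^ 'n \<Rightarrow> real" where
  "monomial x a = (\<Prod>l\<in>UNIV. (x $ l) ^ (a $ l))"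

definition Poly :: "nat ^ 'n ^ 'm \<Rightarrow> real ^ 'm \<Rightarrow> real ^ 'n \<Rightarrow> real" where
  "Poly \<alpha> c x = (\<Sum>j\<in>UNIV. c $ j * monomial x (\<alpha> $ j))"

definition C_AGE_POLY :: "nat ^ 'n ^ 'm \<Rightarrow> 'm \<Rightarrow> (real ^ 'n) set \<Rightarrow> (real ^ 'm) set" where
  "C_AGE_POLY \<alpha> i X = {c.
     (\<forall>x\<in>X. 0 \<le> Poly \<alpha> c x) \<and>
     (\<forall>j. j \<noteq> i \<and> (\<exists>x\<in>X. monomial x (\<alpha> $ j) > 0) \<longrightarrow> c $ j \<ge> 0) \<and>
     (\<forall>j. j \<noteq> i \<and> (\<exists>x\<in>X. monomial x (\<alpha> $ j) < 0) \<longrightarrow> c $ j \<le> 0)}"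

definition C_SAGE_POLY :: "nat ^ 'n ^ 'm \<Rightarrow> (real ^ 'n) set \<Rightarrow> (real ^ 'm) set" where
  "C_SAGE_POLY \<alpha> X = (\<Sum>k\<in>UNIV. C_AGE_POLY \<alpha> k X)"

end

theory Submission
  imports Defs
begin

text \<open>
  The substitution \<open>x = exp y\<close> maps \<open>Y\<close> onto the positive points of \<open>X\<close> and turns polynomials into
  signomials; nonnegativity on those points extends to \<open>X\<close> by continuity.  If \<open>Y\<close> is nonempty, all
  monomials are positive at some point of \<open>X\<close> and negative at none, so the AGE cones agree for
  each index.  If \<open>Y\<close> is empty, the AGE cones differ, but on both sides the \<open>k\<close>-th one contains the
  \<open>k\<close>-th coordinate axis, so both SAGE cones are the whole space.
\<close>

lemma monomial_exp_vec: "monomial (exp_vec y) a = exp ((\<chi> l. real (a $ l)) \<bullet> y)"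
  by (simp add: monomial_def exp_vec_def inner_vec_def exp_sum exp_of_nat_mult)

lemma Poly_exp_vec: "Poly \<alpha> c (exp_vec y) = Sig (map_matrix real \<alpha>) c y"
  by (simp add: Poly_def Sig_def monomial_exp_vec map_matrix_def)

lemma continuous_on_Poly: "continuous_on S (Poly \<alpha> c)"
  unfolding Poly_def monomial_def by (intro continuous_intros)

lemma monomial_nonneg: "0 \<le> x \<Longrightarrow> 0 \<le> monomial x a"
  unfolding monomial_def by (intro prod_nonneg) (simp add: less_eq_vec_def)

lemma range_exp_vec: "range exp_vec = {x. \<forall>l. 0 < x $ l}"
proof -
  have "x = exp_vec (\<chi> l. ln (x $ l))" if "\<forall>l. 0 < x $ l" for x :: "real ^ 'n"
    using that by (simp add: exp_vec_def vec_eq_iff)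
  then have "{x :: real ^ 'n. \<forall>l. 0 < x $ l} \<subseteq> range exp_vec"
    by blast
  moreover have "range exp_vec \<subseteq> {x :: real ^ 'n. \<forall>l. 0 < x $ l}"
    by (auto simp: exp_vec_def)
  ultimately show ?thesis
    by blast
qed

lemma Poly_nonneg_closure_iff:
  "(\<forall>x\<in>closure S. 0 \<le> Poly \<alpha> c x) \<longleftrightarrow> (\<forall>x\<in>S. 0 \<le> Poly \<alpha> c x)"
  using continuous_ge_on_closure[OF continuous_on_Poly] closure_subset by blast

lemma C_AGE_POLY_eq_C_AGE:
  assumes nonneg: "closure (exp_vec ` Y) \<subseteq> {x. 0 \<le> x}" and ne: "Y \<noteq> {}"
  shows "C_AGE_POLY \<alpha> k (closure (exp_vec ` Y)) = C_AGE (map_matrix real \<alpha>) k Y"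
proof -
  let ?X = "closure (exp_vec ` Y)"
  obtain y where "y \<in> Y"
    using ne by blast
  then have "exp_vec y \<in> ?X"
    by (intro subsetD[OF closure_subset] imageI)
  moreover have "0 < monomial (exp_vec y) a" for a
    by (simp add: monomial_exp_vec)
  ultimately have "\<exists>x\<in>?X. 0 < monomial x a" for a
    by blast
  moreover have "\<not> monomial x a < 0" if "x \<in> ?X" for x a
    using nonneg that monomial_nonneg by (auto simp: not_less)
  \<comment> \<open>Positivity somewhere makes the second clause of \<open>C_AGE_POLY\<close> bind
    every index other than \<open>k\<close>; the absence of negative values makes the third clause
    vacuous.\<close>
  ultimately show ?thesis
    unfolding C_AGE_POLY_def C_AGE_def Poly_nonneg_closure_iff by (auto simp: Poly_exp_vec)
qed

text \<open>Every vector is the sum of its coordinate parts, one taken from each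
  \<open>C k\<close>.\<close>

lemma sum_axes_eq_UNIV:
  fixes C :: "'m::finite \<Rightarrow> (real ^ 'm) set"
  assumes "\<And>k t. axis k t \<in> C k"
  shows "(\<Sum>k\<in>UNIV. C k) = UNIV"
proof -
  have "c = (\<Sum>k\<in>UNIV. axis k (c $ k))" for c :: "real ^ 'm"
    by (simp add: vec_eq_iff axis_def)
  then show ?thesis
    using assms by (fastforce simp: set_sum_alt)
qed

theorem theorem9:
  fixes \<alpha> :: "nat ^ 'n ^ 'm"
    and X Y :: "(real ^ 'n) set"
    and H :: "real ^ 'n \<Rightarrow> real ^ 'r"
  assumes X_nonneg: "X \<subseteq> {x. 0 \<le> x}"
    and H_cont: "continuous_on UNIV H"
    and X_rep: "X = closure {x. (\<forall>l. 0 < x $ l) \<and> H x \<le> 1}"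
    and Y_def: "Y = {y. H (exp_vec y) \<le> 1}"
  shows "C_SAGE_POLY \<alpha> X = C_SAGE (map_matrix real \<alpha>) Y"
proof -
  \<comment> \<open>\<open>Y\<close> is the preimage of \<open>{x. H x \<le> 1}\<close> under
    \<open>exp_vec\<close>, so its image is cut out by the range, the open positive orthant.\<close>
  have "exp_vec ` Y = range exp_vec \<inter> {x. H x \<le> 1}"
    by (auto simp: Y_def)
  then have X: "X = closure (exp_vec ` Y)"
    by (simp add: X_rep range_exp_vec Collect_conj_eq)
  show ?thesis
  proof (cases "Y = {}")
    case True
    then have "C_SAGE_POLY \<alpha> X = UNIV"
      \<comment> \<open>The closure of the empty set is empty, so all three clauses hold
        vacuously.\<close>
      unfolding C_SAGE_POLY_def X by (intro sum_axes_eq_UNIV) (simp add: C_AGE_POLY_def)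
    moreover from True have "C_SAGE (map_matrix real \<alpha>) Y = UNIV"
      \<comment> \<open>The sign condition survives here, but \<open>axis k t\<close> vanishes off
        \<open>k\<close>, so \<open>t\<close> may have any sign.\<close>
      unfolding C_SAGE_def by (intro sum_axes_eq_UNIV) (simp add: C_AGE_def axis_def)
    ultimately show ?thesis
      by simp
  next
    case False
    then show ?thesis
      using X_nonneg by (simp add: C_SAGE_POLY_def C_SAGE_def X C_AGE_POLY_eq_C_AGE)
  qed
qed

end
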